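(* If the complement $\overline{G}$ of a graph $G$ is a bipartite graph, then $\chi_{i}(G)=\omega\big(\mathcal{N}(G)\big)$.
   Context: All graphs are finite and simple. An injective $k$-coloring function of a graph $G$ is a function $f:V(G)\to\{1,\dots,k\}$ such that no vertex $v$ is adjacent to two distinct vertices $u$ and $w$ with $f(u)=f(w)$ (adjacent vertices may receive the same color). The injective chromatic number $\chi_i(G)$ is the minimum $k$ for which $G$ admits an injective $k$-coloring function. The two-step graph $\mathcal{N}(G)$ of $G$ is the graph with vertex set $V(G)$ in which two distinct vertices are adjacent if and only if they have a common neighbor in $G$. $\omega$ denotes the clique number. *)

theory Defs
  imports "Graph_Theory.Pair_Digraph"
begin

text \<open>
  A finite simple graph is a \<^locale>\<open>pair_graph\<close>: finitely many vertices, and a symmetric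
  irreflexive set of arcs between them, each edge being represented by its two orientations.
  The graph without vertices is allowed.
\<close>

definition injective_coloring :: "'a pair_pre_digraph \<Rightarrow> nat \<Rightarrow> ('a \<Rightarrow> nat) \<Rightarrow> bool" where
  "injective_coloring G k f \<longleftrightarrow>
     f \<in> pverts G \<rightarrow> {1..k} \<and>
     \<not> (\<exists>v\<in>pverts G. \<exists>u\<in>pverts G. \<exists>w\<in>pverts G.
          u \<noteq> w \<and> (v, u) \<in> parcs G \<and> (v, w) \<in> parcs G \<and> f u = f w)"

definition injective_chromatic_number :: "'a pair_pre_digraph \<Rightarrow> nat" where
  "injective_chromatic_number G = (LEAST k. \<exists>f. injective_coloring G k f)"

definition two_step_graph :: "'a pair_pre_digraph \<Rightarrow> 'a pair_pre_digraph" where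
  "two_step_graph G = \<lparr> pverts = pverts G,
     parcs = {(u, w). u \<in> pverts G \<and> w \<in> pverts G \<and> u \<noteq> w \<and>
                (\<exists>v\<in>pverts G. (u, v) \<in> parcs G \<and> (w, v) \<in> parcs G)} \<rparr>"

definition complement_graph :: "'a pair_pre_digraph \<Rightarrow> 'a pair_pre_digraph" where
  "complement_graph G = \<lparr> pverts = pverts G,
     parcs = {(u, v). u \<in> pverts G \<and> v \<in> pverts G \<and> u \<noteq> v \<and> (u, v) \<notin> parcs G} \<rparr>"

text \<open>Either part of the bipartition may be empty.\<close>

definition bipartite :: "'a pair_pre_digraph \<Rightarrow> bool" where
  "bipartite G \<longleftrightarrow>
     (\<exists>A B. pverts G = A \<union> B \<and> A \<inter> B = {} \<and>
        (\<forall>(u, v)\<in>parcs G. (u \<in> A \<and> v \<in> B) \<or> (u \<in> B \<and> v \<in> A)))"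

definition clique :: "'a pair_pre_digraph \<Rightarrow> 'a set \<Rightarrow> bool" where
  "clique G C \<longleftrightarrow> C \<subseteq> pverts G \<and> (\<forall>u\<in>C. \<forall>v\<in>C. u \<noteq> v \<longrightarrow> (u, v) \<in> parcs G)"

definition clique_number :: "'a pair_pre_digraph \<Rightarrow> nat" where
  "clique_number G = Max (card ` {C. clique G C})"

lemma pair_graph_complement_graph:
  assumes "pair_graph G"
  shows "pair_graph (complement_graph G)"
proof -
  interpret pair_graph G by fact
  have "finite {(u, v). u \<in> pverts G \<and> v \<in> pverts G \<and> u \<noteq> v \<and> (u, v) \<notin> parcs G}"
    by (rule finite_subset[of _ "pverts G \<times> pverts G"]) auto
  then show ?thesis
    using pair_sym_arcs
    by unfold_locales
      (auto simp: complement_graph_def symmetric_def intro!: symI dest: symD)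
qed

lemma pair_graph_two_step_graph:
  assumes "pair_graph G"
  shows "pair_graph (two_step_graph G)"
proof -
  interpret pair_graph G by fact
  have "finite {(u, w). u \<in> pverts G \<and> w \<in> pverts G \<and> u \<noteq> w \<and>
                (\<exists>v\<in>pverts G. (u, v) \<in> parcs G \<and> (w, v) \<in> parcs G)}"
    by (rule finite_subset[of _ "pverts G \<times> pverts G"]) auto
  then show ?thesis
    by unfold_locales (auto simp: two_step_graph_def symmetric_def intro!: symI)
qed

lemma injective_coloring_exists:
  assumes "pair_graph G"
  shows "\<exists>k f. injective_coloring G k f"
proof -
  interpret pair_graph G by fact
  obtain f :: "'a \<Rightarrow> nat" where f: "bij_betw f (pverts G) {1..card (pverts G)}"
    by (metis finite_same_card_bij card_atLeastAtMost diff_Suc_1 finite_atLeastAtMost pair_finite_verts)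
  then have "injective_coloring G (card (pverts G)) f"
    by (auto simp: injective_coloring_def bij_betw_def inj_on_def)
  then show ?thesis by blast
qed

lemma finite_cliques:
  assumes "pair_graph G"
  shows "finite {C. clique G C}" and "clique G {}"
proof -
  interpret pair_graph G by fact
  show "finite {C. clique G C}"
    by (rule finite_subset[of _ "Pow (pverts G)"]) (auto simp: clique_def)
  show "clique G {}" by (simp add: clique_def)
qed

end

theory Submission
  imports Defs
begin

text \<open>
  An injective coloring of \<open>G\<close> is a proper coloring of \<open>\<N>(G)\<close>, so it suffices to map
  \<open>\<N>(G)\<close> homomorphically onto one of its cliques. Let \<open>V(G) = A \<union> B\<close> with \<open>A\<close> and \<open>B\<close> cliques
  of \<open>G\<close>. A clique with at least three vertices stays a clique in \<open>\<N>(G)\<close>. If \<open>A\<close> and \<open>B\<close> are both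
  cliques of \<open>\<N>(G)\<close>, then \<open>a \<in> A\<close> and \<open>b \<in> B\<close> are non-adjacent in \<open>\<N>(G)\<close> only if \<open>ab\<close> is an isolated
  edge of the bipartite graph between \<open>A\<close> and \<open>B\<close>, or both are isolated in it; so a maximum
  matching of such pairs is explicit, and folding along it gives the homomorphism.
  Otherwise one side, say \<open>A\<close>, consists of two vertices without a common neighbor, and
  the homomorphism is found by hand.
\<close>

section \<open>Colorings of a graph by one of its own cliques\<close>

text \<open>\<open>r\<close> is a proper coloring whose colors are vertices of \<open>C\<close>. It
  need not fix \<open>C\<close> pointwise, since only the number of colors matters.\<close>

definition folds_onto_clique :: "'a pair_pre_digraph \<Rightarrow> bool" where
  "folds_onto_clique H \<longleftrightarrow> (\<exists>C r. clique H C \<and> r \<in> pverts H \<rightarrow> C \<and>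
     (\<forall>(u, w)\<in>parcs H. r u \<noteq> r w))"

lemma folds_onto_cliqueI:
  assumes "clique H C" "r \<in> pverts H \<rightarrow> C" "\<And>u w. (u, w) \<in> parcs H \<Longrightarrow> r u \<noteq> r w"
  shows "folds_onto_clique H"
  using assms unfolding folds_onto_clique_def by blast

lemma folds_onto_clique_no_arcs:
  assumes "parcs H = {}"
  shows "folds_onto_clique H"
proof (cases "pverts H = {}")
  case True
  then show ?thesis
    by (intro folds_onto_cliqueI[of _ "{}" id]) (auto simp: assms clique_def)
next
  case False
  then obtain x where "x \<in> pverts H" by blast
  then show ?thesis
    by (intro folds_onto_cliqueI[of _ "{x}" "\<lambda>_. x"]) (auto simp: assms clique_def)
qed

text \<open>Distinct members of \<open>C\<close> share a neighbor in \<open>G\<close>, so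
  \<open>f\<close> separates them.\<close>

lemma card_clique_le_injective_coloring:
  assumes "pair_graph G" "injective_coloring G k f" "clique (two_step_graph G) C"
  shows "card C \<le> k"
proof -
  interpret pair_graph G by fact
  have "inj_on f C"
  proof (rule inj_onI, rule ccontr)
    fix u w assume uw: "u \<in> C" "w \<in> C" "f u = f w" "u \<noteq> w"
    with assms(3) have "(u, w) \<in> parcs (two_step_graph G)" by (simp add: clique_def)
    then obtain v where "v \<in> pverts G" "(u, v) \<in> parcs G" "(w, v) \<in> parcs G"
      "u \<in> pverts G" "w \<in> pverts G"
      by (auto simp: two_step_graph_def)
    moreover from this have "(v, u) \<in> parcs G" "(v, w) \<in> parcs G"
      using pair_sym_arcs by (auto simp: symmetric_def dest: symD)
    ultimately show False
      using assms(2) uw unfolding injective_coloring_def by blast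
  qed
  moreover have "f ` C \<subseteq> {1..k}"
    using assms(2,3) by (auto simp: injective_coloring_def clique_def two_step_graph_def)
  ultimately show ?thesis
    using card_inj_on_le[of f C "{1..k}"] by simp
qed

text \<open>Numbering \<open>C\<close> turns \<open>r\<close> into an injective coloring with
  \<open>card C\<close> colors, and \<open>card C\<close> is at most the clique number; the
  preceding lemma gives the reverse bound.\<close>

lemma injective_chromatic_number_eq_clique_number:
  assumes G: "pair_graph G" and "folds_onto_clique (two_step_graph G)"
  shows "injective_chromatic_number G = clique_number (two_step_graph G)"
proof -
  interpret pair_graph G by fact
  let ?N = "two_step_graph G"
  let ?K = "card ` {C. clique ?N C}"
  obtain C r where C: "clique ?N C" "r \<in> pverts G \<rightarrow> C"
    and r: "\<And>u w. (u, w) \<in> parcs ?N \<Longrightarrow> r u \<noteq> r w"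
    using assms(2) unfolding folds_onto_clique_def by (auto simp: two_step_graph_def)
  have "finite C"
    using C(1) finite_subset[of C "pverts G"] by (auto simp: clique_def two_step_graph_def)
  then obtain h :: "'a \<Rightarrow> nat" where h: "bij_betw h C {1..card C}"
    using finite_same_card_bij[of C "{1..card C}"] by auto
  have "injective_coloring G (card C) (h \<circ> r)"
    unfolding injective_coloring_def
  proof (intro conjI notI)
    show "h \<circ> r \<in> pverts G \<rightarrow> {1..card C}"
      using C(2) bij_betwE[OF h] by (force simp: Pi_def)
    assume "\<exists>v\<in>pverts G. \<exists>u\<in>pverts G. \<exists>w\<in>pverts G. u \<noteq> w \<and>
      (v, u) \<in> parcs G \<and> (v, w) \<in> parcs G \<and> (h \<circ> r) u = (h \<circ> r) w"
    then obtain v u w where uw: "v \<in> pverts G" "u \<in> pverts G" "w \<in> pverts G" "u \<noteq> w"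
      "(v, u) \<in> parcs G" "(v, w) \<in> parcs G" "h (r u) = h (r w)" by auto
    then have "(u, v) \<in> parcs G" "(w, v) \<in> parcs G"
      using pair_sym_arcs by (auto simp: symmetric_def dest: symD)
    with uw have "(u, w) \<in> parcs ?N" by (auto simp: two_step_graph_def)
    moreover have "r u = r w"
      using uw C(2) bij_betw_imp_inj_on[OF h] by (meson PiE inj_onD)
    ultimately show False using r by blast
  qed
  then have "injective_chromatic_number G \<le> card C"
    unfolding injective_chromatic_number_def by (intro Least_le) blast
  moreover have fin: "finite ?K"
    using finite_cliques(1)[OF pair_graph_two_step_graph[OF G]] by blast
  then have "card C \<le> clique_number ?N"
    using C(1) unfolding clique_number_def by (intro Max_ge) auto
  moreover have "clique_number ?N \<le> injective_chromatic_number G"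
  proof -
    obtain f where f: "injective_coloring G (injective_chromatic_number G) f"
      unfolding injective_chromatic_number_def
      using LeastI_ex[OF injective_coloring_exists[OF G]] by blast
    show ?thesis
      unfolding clique_number_def
      using fin C(1) card_clique_le_injective_coloring[OF G f] by (subst Max_le_iff) auto
  qed
  ultimately show ?thesis by linarith
qed

section \<open>Graphs covered by two disjoint cliques\<close>

locale two_clique_graph = pair_graph G for G :: "'a pair_pre_digraph" (structure) +
  fixes A B :: "'a set"
  assumes verts: "pverts G = A \<union> B"
    and disjoint: "A \<inter> B = {}"
    and complete_A: "u \<in> A \<Longrightarrow> v \<in> A \<Longrightarrow> u \<noteq> v \<Longrightarrow> (u, v) \<in> parcs G"
    and complete_B: "u \<in> B \<Longrightarrow> v \<in> B \<Longrightarrow> u \<noteq> v \<Longrightarrow> (u, v) \<in> parcs G"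
begin

abbreviation N where "N \<equiv> two_step_graph G"

text \<open>Lets the later lemmas be proved for one side only.\<close>

lemma swap: "two_clique_graph G B A"
  using verts disjoint complete_A complete_B by unfold_locales auto

lemma arc_sym: "(u, v) \<in> parcs G \<Longrightarrow> (v, u) \<in> parcs G"
  using pair_sym_arcs by (auto simp: symmetric_def dest: symD)

lemma arc_irrefl: "(u, u) \<notin> parcs G"
  using pair_no_loops by fastforce

lemma arc_verts: "(u, v) \<in> parcs G \<Longrightarrow> u \<in> A \<union> B \<and> v \<in> A \<union> B"
  using verts in_arcsD1 in_arcsD2 by auto

lemma arc_N: "(u, w) \<in> parcs N \<longleftrightarrow> u \<noteq> w \<and> (\<exists>v. (u, v) \<in> parcs G \<and> (w, v) \<in> parcs G)"
  using arc_verts verts unfolding two_step_graph_def by fastforce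

lemma arc_N_sym: "(u, w) \<in> parcs N \<Longrightarrow> (w, u) \<in> parcs N"
  by (auto simp: arc_N)

lemma verts_N: "pverts N = A \<union> B"
  by (simp add: two_step_graph_def verts)

text \<open>A third vertex of the clique \<open>A\<close> would be a common neighbor.\<close>

lemma eq_pair_if_not_arc_N:
  assumes "a \<in> A" "a' \<in> A" "a \<noteq> a'" "(a, a') \<notin> parcs N"
  shows "A = {a, a'}"
  using assms complete_A unfolding arc_N by blast

text \<open>Vertices of \<open>B\<close> are merged with partners in \<open>A\<close> with which
  they share no neighbor. By \<open>le\<close>, every vertex of \<open>B\<close> without neighbors
  in \<open>A\<close> gets a partner; \<open>A\<close> and the unmatched rest of \<open>B\<close>
  form a clique of \<open>N\<close>.\<close>

lemma folds_if_cliques: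
  assumes A: "clique N A" and B: "clique N B"
    and le: "card {b \<in> B. \<forall>a\<in>A. (a, b) \<notin> parcs G} \<le> card {a \<in> A. \<forall>b\<in>B. (a, b) \<notin> parcs G}"
  shows "folds_onto_clique N"
proof -
  let ?E = "parcs G"
  define A0 where "A0 = {a \<in> A. \<forall>b\<in>B. (a, b) \<notin> ?E}"
  define B0 where "B0 = {b \<in> B. \<forall>a\<in>A. (a, b) \<notin> ?E}"
  define isolated where "isolated a b \<longleftrightarrow> a \<in> A \<and> b \<in> B \<and> (a, b) \<in> ?E \<and>
    (\<forall>b'\<in>B. (a, b') \<in> ?E \<longrightarrow> b' = b) \<and> (\<forall>a'\<in>A. (a', b) \<in> ?E \<longrightarrow> a' = a)" for a b
  define B1 where "B1 = {b. \<exists>a. isolated a b}"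
  have "finite A" "finite B" using verts pair_finite_verts by auto
  then have "finite A0" "finite B0" by (auto simp: A0_def B0_def)
  with le obtain g where g: "g ` B0 \<subseteq> A0" "inj_on g B0"
    using card_le_inj[of B0 A0] unfolding A0_def B0_def by blast
  define m where "m b = (SOME a. isolated a b)" for b
  have m: "isolated (m b) b" if "b \<in> B1" for b
    using that unfolding B1_def m_def by (auto intro: someI)
  \<comment> \<open>\<open>B0\<close> and \<open>B1\<close> are disjoint, as an isolated edge gives
    its end in \<open>B\<close> a neighbor in \<open>A\<close>.\<close>
  define p where "p b = (if b \<in> B0 then g b else m b)" for b
  have p_A: "p b \<in> A" if "b \<in> B0 \<union> B1" for b
    using that g(1) m[of b] unfolding p_def A0_def isolated_def by auto
  have p_inj: "b = b'" if "b \<in> B0 \<union> B1" "b' \<in> B0 \<union> B1" "p b = p b'" for b b'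
  proof (cases "b \<in> B0"; cases "b' \<in> B0")
    assume "b \<in> B0" "b' \<in> B0"
    then show ?thesis using that g(2) by (auto simp: p_def dest: inj_onD)
  next
    \<comment> \<open>Values of \<open>g\<close> have no neighbor in \<open>B\<close>, values of
      \<open>m\<close> on \<open>B1\<close> have one, so they never coincide.\<close>
    assume "b \<in> B0" "b' \<notin> B0"
    moreover from this have "p b \<in> A0" "isolated (p b') b'"
      using g(1) m[of b'] that by (auto simp: p_def)
    ultimately show ?thesis using that by (auto simp: A0_def isolated_def)
  next
    assume "b \<notin> B0" "b' \<in> B0"
    moreover from this have "p b' \<in> A0" "isolated (p b) b"
      using g(1) m[of b] that by (auto simp: p_def)
    ultimately show ?thesis using that by (auto simp: A0_def isolated_def)
  next
    assume "b \<notin> B0" "b' \<notin> B0"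
    then have "isolated (p b) b" "isolated (p b') b'"
      using m[of b] m[of b'] that by (auto simp: p_def)
    then show ?thesis using that by (auto simp: isolated_def)
  qed
  have p_N: "(p b, b) \<notin> parcs N" if b: "b \<in> B0 \<union> B1" for b
  proof
    assume "(p b, b) \<in> parcs N"
    then obtain v where v: "(p b, v) \<in> ?E" "(b, v) \<in> ?E" by (auto simp: arc_N)
    then have v': "v \<in> A \<union> B" "(v, b) \<in> ?E" using arc_verts arc_sym by blast+
    show False
    proof (cases "b \<in> B0")
      case True
      then have "p b \<in> A0" using g(1) by (auto simp: p_def)
      then show False using v v' True by (auto simp: A0_def B0_def)
    next
      case False
      then have "isolated (p b) b" using b m by (auto simp: p_def)
      \<comment> \<open>Isolation forces \<open>v\<close> to be \<open>p b\<close> or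
        \<open>b\<close>, which would create a loop.\<close>
      then show False using v v' arc_irrefl by (auto simp: isolated_def)
    qed
  qed
  have B01: "B0 \<union> B1 \<subseteq> B" by (auto simp: B0_def B1_def isolated_def)
  define r where "r x = (if x \<in> B0 \<union> B1 then p x else x)" for x
  define C where "C = A \<union> (B - (B0 \<union> B1))"
  have cross: "(a, b) \<in> parcs N" if a: "a \<in> A" and b: "b \<in> B" "b \<notin> B0" "b \<notin> B1" for a b
  proof -
    have "a \<noteq> b" using a b disjoint by blast
    obtain a' where a': "a' \<in> A" "(a', b) \<in> ?E" using b by (auto simp: B0_def)
    show ?thesis
    \<comment> \<open>A second neighbor of \<open>b\<close> in \<open>A\<close> is also adjacent to
      \<open>a\<close>. Without one, \<open>a\<close> must have a second neighbor in
      \<open>B\<close>, since the edge is not isolated, and that one is adjacent to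
      \<open>b\<close>.\<close>
    proof (cases "\<exists>a''\<in>A. (a'', b) \<in> ?E \<and> a'' \<noteq> a")
      case True
      then show ?thesis using \<open>a \<noteq> b\<close> a complete_A arc_sym unfolding arc_N by blast
    next
      case False
      with a' have ab: "(a, b) \<in> ?E" by blast
      have "\<not> isolated a b" using b(3) by (auto simp: B1_def)
      then obtain b' where "b' \<in> B" "(a, b') \<in> ?E" "b' \<noteq> b"
        using False ab a b(1) unfolding isolated_def by blast
      then show ?thesis using \<open>a \<noteq> b\<close> b complete_B unfolding arc_N by blast
    qed
  qed
  show ?thesis
  proof (rule folds_onto_cliqueI)
    show "clique N C"
      using A B cross arc_N_sym unfolding clique_def C_def verts_N by blast
    show "r \<in> pverts N \<rightarrow> C"
      using p_A B01 disjoint by (auto simp: r_def C_def verts_N)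
    fix u w assume uw: "(u, w) \<in> parcs N"
    then have "u \<noteq> w" "(w, u) \<in> parcs N" by (auto simp: arc_N)
    then show "r u \<noteq> r w"
      using uw p_inj[of u w] p_N[of u] p_N[of w] by (auto simp: r_def split: if_splits)
  qed
qed

text \<open>\<open>A\<close> is a pair without a common neighbor, hence independent in
  \<open>N\<close>, so its two vertices may share a value. What remains is to find the
  clique.\<close>

lemma folds_if_not_clique:
  assumes "\<not> clique N A"
  shows "folds_onto_clique N"
proof -
  let ?E = "parcs G"
  obtain a1 a2 where a12: "a1 \<in> A" "a2 \<in> A" "a1 \<noteq> a2" "(a1, a2) \<notin> parcs N"
    using assms verts_N unfolding clique_def by auto
  have A: "A = {a1, a2}" by (rule eq_pair_if_not_arc_N[OF a12])
  have A_N: "(u, w) \<notin> parcs N" if "u \<in> A" "w \<in> A" for u w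
    using that a12(4) arc_N_sym[of a2 a1] unfolding A by (auto simp: arc_N)
  have no_common: "u = w" if "u \<in> A" "w \<in> A" "(u, v) \<in> ?E" "(w, v) \<in> ?E" for u v w
    using that A_N unfolding arc_N by blast
  show ?thesis
  proof (cases "\<exists>a\<in>A. \<exists>b\<in>B. \<exists>b'\<in>B. b \<noteq> b' \<and> (a, b) \<in> ?E \<and> (a, b') \<in> ?E")
    case True
    then obtain a b b' where a: "a \<in> A" "b \<in> B" "b' \<in> B" "b \<noteq> b'" "(a, b) \<in> ?E" "(a, b') \<in> ?E"
      by blast
    \<comment> \<open>One of \<open>b\<close>, \<open>b'\<close> differs from \<open>x\<close> and
      is then a common neighbor of \<open>a\<close> and \<open>x\<close>.\<close>
    have aB: "(a, x) \<in> parcs N" if "x \<in> B" for x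
    proof -
      have "a \<noteq> x" using that a disjoint by blast
      obtain y where "y \<in> B" "y \<noteq> x" "(a, y) \<in> ?E" using a by metis
      then show ?thesis using that \<open>a \<noteq> x\<close> complete_B unfolding arc_N by blast
    qed
    \<comment> \<open>If \<open>B\<close> were only a pair, it would be \<open>{b, b'}\<close>, with
      common neighbor \<open>a\<close>.\<close>
    have BB: "(x, y) \<in> parcs N" if "x \<in> B" "y \<in> B" "x \<noteq> y" for x y
    proof (rule ccontr)
      assume n: "(x, y) \<notin> parcs N"
      interpret sw: two_clique_graph G B A by (rule swap)
      have "B = {x, y}" by (rule sw.eq_pair_if_not_arc_N[OF that n])
      then have "(x, a) \<in> ?E" "(y, a) \<in> ?E" using a arc_sym by auto
      then show False using n that unfolding arc_N by blast
    qed
    show ?thesis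
    proof (rule folds_onto_cliqueI)
      show "clique N (insert a B)"
        using a aB BB arc_N_sym unfolding clique_def verts_N by blast
      show "(\<lambda>x. if x \<in> A then a else x) \<in> pverts N \<rightarrow> insert a B" by (auto simp: verts_N)
      fix u w assume uw: "(u, w) \<in> parcs N"
      then have "u \<noteq> w" by (simp add: arc_N)
      then show "(if u \<in> A then a else u) \<noteq> (if w \<in> A then a else w)"
        using uw A_N a(1) by auto
    qed
  next
    case False
    then have nbr_unique: "b = b'"
      if "a \<in> A" "b \<in> B" "b' \<in> B" "(a, b) \<in> ?E" "(a, b') \<in> ?E" for a b b'
      using that by blast
    show ?thesis
    proof (cases "clique N B \<and> (\<exists>b\<in>B. \<exists>b'\<in>B. b \<noteq> b')")
      case True
      \<comment> \<open>Such a \<open>b\<close> can serve as the value of \<open>a\<close>. If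
        \<open>a\<close> has a neighbor in \<open>B\<close>, that neighbor works, by
        \<open>no_common\<close> and \<open>nbr_unique\<close>.\<close>
      have "\<exists>b\<in>B. (a, b) \<notin> parcs N" if a: "a \<in> A" for a
      proof -
        obtain a' where a': "a' \<in> A" "A = {a, a'}" using a A a12 by auto
        show ?thesis
        proof (cases "\<exists>b\<in>B. (a, b) \<in> ?E")
          case True
          then obtain b where b: "b \<in> B" "(a, b) \<in> ?E" by blast
          have "(a, b) \<notin> parcs N"
          proof
            assume "(a, b) \<in> parcs N"
            then obtain v where "(a, v) \<in> ?E" "(b, v) \<in> ?E" by (auto simp: arc_N)
            then show False
              using a b no_common[of a v b] nbr_unique[of a b v] arc_verts[of a v] arc_sym
                arc_irrefl by (metis UnE)
          qed
          then show ?thesis using b by blast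
        next
          case no: False
          \<comment> \<open>Now \<open>a'\<close> is the only possible neighbor of \<open>a\<close>;
            it has at most one neighbor in \<open>B\<close>, while \<open>B\<close> has two
            vertices.\<close>
          obtain b where b: "b \<in> B" "(a', b) \<notin> ?E"
            using True nbr_unique[OF a'(1)] by blast
          have "(a, b) \<notin> parcs N"
          proof
            assume "(a, b) \<in> parcs N"
            then obtain v where v: "(a, v) \<in> ?E" "(b, v) \<in> ?E" by (auto simp: arc_N)
            then have "v = a'" using no a' arc_verts[of a v] arc_irrefl by auto
            then show False using v b arc_sym by blast
          qed
          then show ?thesis using b by blast
        qed
      qed
      then obtain c where c: "\<And>a. a \<in> A \<Longrightarrow> c a \<in> B \<and> (a, c a) \<notin> parcs N" by metis
      show ?thesis
      proof (rule folds_onto_cliqueI)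
        show "clique N B" using True by blast
        show "(\<lambda>x. if x \<in> A then c x else x) \<in> pverts N \<rightarrow> B" using c by (auto simp: verts_N)
        fix u w assume uw: "(u, w) \<in> parcs N"
        then have "u \<noteq> w" "(w, u) \<in> parcs N" by (auto simp: arc_N)
        then show "(if u \<in> A then c u else u) \<noteq> (if w \<in> A then c w else w)"
          using uw A_N c by auto
      qed
    next
      case False
      \<comment> \<open>Either \<open>B\<close> has at most one vertex or it is a pair without a
        common neighbor. So \<open>N\<close> is bipartite, and any edge of it is a sufficient
        clique.\<close>
      have B_N: "(u, w) \<notin> parcs N" if "u \<in> B" "w \<in> B" for u w
      proof (cases "clique N B")
        case True
        then show ?thesis using False that by (auto simp: arc_N)
      next
        case nB: False
        interpret sw: two_clique_graph G B A by (rule swap)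
        obtain x y where xy: "x \<in> B" "y \<in> B" "x \<noteq> y" "(x, y) \<notin> parcs N"
          using nB verts_N unfolding clique_def by auto
        have "B = {x, y}" by (rule sw.eq_pair_if_not_arc_N[OF xy])
        then show ?thesis
          using that xy(4) arc_N_sym[of y x] by (auto simp: arc_N)
      qed
      show ?thesis
      proof (cases "\<exists>a\<in>A. \<exists>b\<in>B. (a, b) \<in> parcs N")
        case True
        then obtain a b where ab: "a \<in> A" "b \<in> B" "(a, b) \<in> parcs N" by blast
        show ?thesis
        proof (rule folds_onto_cliqueI)
          show "clique N {a, b}"
            using ab arc_N_sym unfolding clique_def verts_N by blast
          show "(\<lambda>x. if x \<in> A then a else b) \<in> pverts N \<rightarrow> {a, b}" by auto
          fix u w assume uw: "(u, w) \<in> parcs N"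
          then have "u \<in> A \<union> B" "w \<in> A \<union> B" by (auto simp: two_step_graph_def verts)
          then show "(if u \<in> A then a else b) \<noteq> (if w \<in> A then a else b)"
            using uw A_N B_N ab disjoint by auto
        qed
      next
        case False
        then have "parcs N = {}"
        proof -
          have "(u, w) \<notin> parcs N" for u w
          proof
            assume uw: "(u, w) \<in> parcs N"
            then have "u \<in> A \<union> B" "w \<in> A \<union> B" by (auto simp: two_step_graph_def verts)
            then show False using uw arc_N_sym[OF uw] False A_N B_N by blast
          qed
          then show ?thesis by auto
        qed
        then show ?thesis by (rule folds_onto_clique_no_arcs)
      qed
    qed
  qed
qed

lemma folds: "folds_onto_clique N"
proof -
  interpret sw: two_clique_graph G B A by (rule swap)
  let ?A0 = "{a \<in> A. \<forall>b\<in>B. (a, b) \<notin> parcs G}"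
  let ?B0 = "{b \<in> B. \<forall>a\<in>A. (a, b) \<notin> parcs G}"
  \<comment> \<open>The swapped instance states cross arcs in the opposite orientation.\<close>
  have eq: "{a \<in> A. \<forall>b\<in>B. (b, a) \<notin> parcs G} = ?A0" "{b \<in> B. \<forall>a\<in>A. (b, a) \<notin> parcs G} = ?B0"
    using arc_sym by blast+
  show ?thesis
  proof (cases "clique N A \<and> clique N B")
    case True
    then show ?thesis
      using folds_if_cliques sw.folds_if_cliques linear[of "card ?B0" "card ?A0"]
      unfolding eq by (elim disjE) simp_all
  next
    case False
    then show ?thesis using folds_if_not_clique sw.folds_if_not_clique by blast
  qed
qed

end

theorem theorem10:
  fixes G :: "'a pair_pre_digraph"
  assumes "pair_graph G"
    and "bipartite (complement_graph G)"
  shows "injective_chromatic_number G = clique_number (two_step_graph G)"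
proof -
  interpret pair_graph G by fact
  obtain A B where AB: "pverts G = A \<union> B" "A \<inter> B = {}"
    and cross: "\<And>u v. (u, v) \<in> parcs (complement_graph G) \<Longrightarrow>
      (u \<in> A \<and> v \<in> B) \<or> (u \<in> B \<and> v \<in> A)"
    using assms(2) unfolding bipartite_def complement_graph_def by auto
  \<comment> \<open>The parts are independent in the complement, hence cliques of
    \<open>G\<close>.\<close>
  have complete: "(u, v) \<in> parcs G"
    if "u \<noteq> v" "u \<in> A \<and> v \<in> A \<or> u \<in> B \<and> v \<in> B" for u v
  proof (rule ccontr)
    assume "(u, v) \<notin> parcs G"
    then have "(u, v) \<in> parcs (complement_graph G)"
      using that AB(1) by (auto simp: complement_graph_def)
    then show False using cross that(2) AB(2) by blast
  qed
  interpret two_clique_graph G A B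
    by unfold_locales (use AB complete in auto)
  show ?thesis
    by (rule injective_chromatic_number_eq_clique_number[OF assms(1) folds])
qed

end
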